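(* Let $f\in\mathcal{C}_{e}$ with $f(z)=z+a_2z^2+a_3z^3+\cdots$. Then $$|H_4(1)|\le 0.00101775,$$ where, with $a_1=1$, $$H_4(1)=\begin{vmatrix} a_1 & a_2 & a_3 & a_4 \\ a_2 & a_3 & a_4 & a_5 \\ a_3 & a_4 & a_5 & a_6 \\ a_4 & a_5 & a_6 & a_7 \end{vmatrix}.$$
   Context: Let $\mathbb{D}=\{z\in\mathbb{C}:|z|<1\}$ and let $\mathcal{A}$ be the set of analytic functions $f$ on $\mathbb{D}$ of the form $f(z)=z+a_2z^2+a_3z^3+\cdots$. For functions $h_1,h_2$ analytic on $\mathbb{D}$, $h_1\prec h_2$ ($h_1$ is subordinate to $h_2$) means that there is a Schwarz function $w$, i.e. an analytic $w$ on $\mathbb{D}$ with $w(0)=0$ and $|w(z)|\le|z|$, such that $h_1(z)=h_2(w(z))$ on $\mathbb{D}$. The class $\mathcal{C}_{e}$ is $$\mathcal{C}_{e}=\left\{f\in\mathcal{A}:1+\frac{zf''(z)}{f'(z)}\prec e^{z}\right\}.$$ For $f\in\mathcal{A}$ with $a_1=1$, the Hankel determinant $H_q(n)$ is the determinant of the $q\times q$ matrix whose $(i,j)$ entry is $a_{n+i+j-2}$, $1\le i,j\le q$. *)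

theory Defs
  imports
    "HOL-Complex_Analysis.Complex_Analysis"
    "Jordan_Normal_Form.Determinant"
begin

abbreviation unit_disc :: "complex set" where
  "unit_disc \<equiv> ball 0 1"

(* The n-th coefficient of the power series of f about 0, i.e. the a_n in
   f z = a_0 + a_1 z + a_2 z^2 + ... *)
definition taylor_coeff :: "(complex \<Rightarrow> complex) \<Rightarrow> nat \<Rightarrow> complex" where
  "taylor_coeff f n = fps_nth (fps_expansion f 0) n"

definition normalized_class :: "(complex \<Rightarrow> complex) set" where
  "normalized_class =
     {f. f holomorphic_on unit_disc \<and> taylor_coeff f 0 = 0 \<and> taylor_coeff f 1 = 1}"

definition schwarz_function :: "(complex \<Rightarrow> complex) \<Rightarrow> bool" where
  "schwarz_function w \<longleftrightarrow>
     w holomorphic_on unit_disc \<and> w 0 = 0 \<and> (\<forall>z\<in>unit_disc. norm (w z) \<le> norm z)"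

definition subordinate :: "(complex \<Rightarrow> complex) \<Rightarrow> (complex \<Rightarrow> complex) \<Rightarrow> bool"
    (infix "\<prec>\<^sub>s" 50) where
  "h1 \<prec>\<^sub>s h2 \<longleftrightarrow>
     h1 holomorphic_on unit_disc \<and> h2 holomorphic_on unit_disc \<and>
     (\<exists>w. schwarz_function w \<and> (\<forall>z\<in>unit_disc. h1 z = h2 (w z)))"

(* Division by zero yields 0, but no function with a critical point enters the class through
   that convention: deriv f 0 = 1, and at any other zero of deriv f in the disc the quotient
   has a pole, which contradicts the holomorphy required by subordination. *)
definition class_Ce :: "(complex \<Rightarrow> complex) set" where
  "class_Ce =
     {f \<in> normalized_class. (\<lambda>z. 1 + z * deriv (deriv f) z / deriv f z) \<prec>\<^sub>s exp}"

(* H_q(n) for the coefficients of f. Matrix indices start at 0 here, so the usual entry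
   a_{n+i+j-2} for 1 <= i, j <= q becomes a_{n+i+j} for i, j < q. *)
definition hankel_det :: "(complex \<Rightarrow> complex) \<Rightarrow> nat \<Rightarrow> nat \<Rightarrow> complex" where
  "hankel_det f q n = Determinant.det (Matrix.mat q q (\<lambda>(i, j). taylor_coeff f (n + i + j)))"

end

theory Submission
  imports Defs
begin

text \<open>Write \<open>z f''/f' = exp w - 1\<close> with a Schwarz function \<open>w = c\<^sub>1 z + c\<^sub>2 z\<^sup>2 + \<dots>\<close>. Comparing
  coefficients turns \<open>a\<^sub>2, \<dots>, a\<^sub>7\<close>, and hence the determinant, into polynomials in
  \<open>c\<^sub>1, \<dots>, c\<^sub>6\<close>. The only analytic information about \<open>w\<close> that enters is
  \<open>\<bar>c\<^sub>1\<bar>\<^sup>2 + \<dots> + \<bar>c\<^sub>6\<bar>\<^sup>2 \<le> 1\<close> (lemma \<open>bessel_inequality\<close>).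

  Because \<open>a\<^sub>1 = 1\<close>, the determinant equals the determinant of the symmetric \<open>3 \<times> 3\<close> Schur
  complement with entries \<open>a\<^bsub>i+j+1\<^esub> - a\<^bsub>i+1\<^esub> a\<^bsub>j+1\<^esub>\<close>, where \<open>1 \<le> i, j \<le> 3\<close>. Each of these is
  a multiple of \<open>c\<^bsub>i+j\<^esub>\<close> plus products of several coefficients, with leading terms

    \<open>c\<^sub>2/6,  c\<^sub>3/12,  c\<^sub>4/20,  c\<^sub>4/20,  c\<^sub>5/30,  c\<^sub>6/42.\<close>

  The products are too large for a direct estimate of the entries. But the determinant does not
  change if multiples of one row are subtracted from another and the same is done to the columns.
  Since the corner entry is exactly \<open>c\<^sub>2/6\<close>, such a congruence removes \<open>c\<^sub>1 c\<^sub>2\<close> from the second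
  entry, reduces the third to \<open>c\<^sub>4/20\<close>, and shrinks most of the remaining products in the others
  (lemma \<open>hankel_reduced\<close>).
  Subject to \<open>\<bar>c\<^sub>1\<bar>\<^sup>2 + \<dots> + \<bar>c\<^sub>6\<bar>\<^sup>2 \<le> 1\<close> the first five reduced entries are now no larger than
  their leading terms allow, namely \<open>1/6, 1/12, 1/20, 1/20, 1/30\<close>, and the last one is at most
  \<open>1/40\<close> (lemma \<open>reduced_entry_bounds\<close>). Expanding the determinant by the triangle inequality
  gives a bound below \<open>0.00098\<close>.\<close>

section \<open>A Bessel inequality for bounded holomorphic functions\<close>

text \<open>Cauchy's formula for the coefficients, as a mean over the circle of radius \<open>r\<close> parametrised by
  \<open>{0..1}\<close>. The real parametrisation, rather than a contour integral, allows real parts to be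
  compared pointwise below.\<close>

lemma coefficient_circle_mean:
  assumes h: "h holomorphic_on ball 0 1" and r: "0 < r" "r < 1"
  shows "((\<lambda>x. h (circlepath 0 r x) / circlepath 0 r x ^ n)
            has_integral fps_nth (fps_expansion h 0) n) {0..1}"
proof -
  have "((\<lambda>u. h u / (u - 0) ^ Suc n) has_contour_integral
           (2 * pi * \<i>) / fact n * (deriv ^^ n) h 0) (circlepath 0 r)"
    using r by (intro Cauchy_has_contour_integral_higher_derivative_circlepath
        holomorphic_on_imp_continuous_on holomorphic_on_subset[OF h]) auto
  hence "((\<lambda>x. h (circlepath 0 r x) / circlepath 0 r x ^ Suc n
             * (2 * pi * \<i> * r * exp (2 * of_real pi * \<i> * x)))
           has_integral (2 * pi * \<i>) / fact n * (deriv ^^ n) h 0) {0..1}"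
    unfolding has_contour_integral_def
    by (rule has_integral_eq[rotated]) (simp add: vector_derivative_circlepath01)
  hence "((\<lambda>x. (2 * pi * \<i>) * (h (circlepath 0 r x) / circlepath 0 r x ^ n))
           has_integral (2 * pi * \<i>) * fps_nth (fps_expansion h 0) n) {0..1}"
    using r by (simp add: circlepath fps_expansion_def field_simps)
  from has_integral_mult_right[OF this, of "inverse (2 * pi * \<i>)"]
  show ?thesis by (simp add: field_simps)
qed

text \<open>Let \<open>S\<close> be the \<open>N\<close>-th partial sum of the power series of \<open>f\<close>. On the circle of radius \<open>r\<close>,
  \<open>\<bar>f\<bar>\<^sup>2 \<ge> \<bar>f\<bar>\<^sup>2 - \<bar>f - S\<bar>\<^sup>2 = Re (cnj S (2 f - S))\<close>. There \<open>cnj (z\<^sup>n) = r\<^bsup>2n\<^esup> / z\<^sup>n\<close>, so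
  the mean of the right-hand side is a combination of coefficients of index below \<open>N\<close> of the
  holomorphic function \<open>2 f - S\<close>, and these are again the coefficients of \<open>f\<close>. Orthogonality of
  the exponentials is therefore already contained in Cauchy's formula.\<close>

lemma bessel_inequality_scaled:
  assumes f: "f holomorphic_on ball 0 1" and bd: "\<And>z. z \<in> ball 0 1 \<Longrightarrow> norm (f z) \<le> 1"
    and r: "0 < r" "r < 1"
  shows "(\<Sum>n<N. (norm (fps_nth (fps_expansion f 0) n))\<^sup>2 * r ^ (2 * n)) \<le> 1"
proof -
  define c where "c = fps_nth (fps_expansion f 0)"
  define S where "S = (\<lambda>z. \<Sum>n<N. c n * z ^ n)"
  define h where "h = (\<lambda>z. 2 * f z - S z)"
  have hol: "h holomorphic_on ball 0 1"
    unfolding h_def S_def by (intro holomorphic_intros f)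
  have S_fps: "S has_fps_expansion (\<Sum>n<N. fps_const (c n) * fps_X ^ n)"
    unfolding S_def by (intro fps_expansion_intros)
  have f_fps: "f has_fps_expansion fps_expansion f 0"
    by (rule has_fps_expansion_fps_expansion[OF _ _ f]) auto
  have h_fps: "h has_fps_expansion
      fps_const 2 * fps_expansion f 0 - (\<Sum>n<N. fps_const (c n) * fps_X ^ n)"
    unfolding h_def by (intro fps_expansion_intros S_fps f_fps)
  have h_coeff: "fps_nth (fps_expansion h 0) n = c n" if "n < N" for n
    using that unfolding fps_expansion_eqI[OF h_fps]
    by (simp add: c_def fps_sum_nth fps_X_power_nth if_distrib sum.delta cong: if_cong)
  define g where "g = circlepath 0 r"
  have g_norm: "norm (g x) = r" for x
    using r by (simp add: g_def circlepath norm_mult)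
  hence g_nz: "g x \<noteq> 0" for x using r by force
  have cnj_g: "cnj (g x) = of_real (r\<^sup>2) / g x" for x
    using complex_norm_square[of "g x"] g_nz[of x] by (simp add: g_norm field_simps)
  have "((\<lambda>x. \<Sum>n<N. (cnj (c n) * of_real (r ^ (2 * n))) * (h (g x) / g x ^ n))
          has_integral (\<Sum>n<N. (cnj (c n) * of_real (r ^ (2 * n))) * c n)) {0..1}"
    using coefficient_circle_mean[OF hol r] h_coeff unfolding g_def
    by (intro has_integral_sum has_integral_mult_right) (auto, metis)
  also have "(\<lambda>x. \<Sum>n<N. (cnj (c n) * of_real (r ^ (2 * n))) * (h (g x) / g x ^ n))
      = (\<lambda>x. cnj (S (g x)) * h (g x))"
    by (simp add: S_def sum_distrib_left sum_distrib_right cnj_g power_divide mult_ac flip: power_mult)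
  also have "(\<Sum>n<N. (cnj (c n) * of_real (r ^ (2 * n))) * c n)
      = of_real (\<Sum>n<N. (norm (c n))\<^sup>2 * r ^ (2 * n))"
    by (simp add: complex_norm_square mult_ac del: of_real_power)
  finally have "((\<lambda>x. cnj (S (g x)) * h (g x)) has_integral
      complex_of_real (\<Sum>n<N. (norm (c n))\<^sup>2 * r ^ (2 * n))) {0..1}" .
  from has_integral_linear[OF this bounded_linear_Re]
  have "((\<lambda>x. Re (cnj (S (g x)) * h (g x)))
      has_integral (\<Sum>n<N. (norm (c n))\<^sup>2 * r ^ (2 * n))) {0..1}"
    by (simp add: o_def)
  moreover have "((\<lambda>x. 1) has_integral (1::real)) {0..1::real}"
    using has_integral_const_real[of "1::real" 0 1] by simp
  moreover have "Re (cnj (S (g x)) * h (g x)) \<le> 1" for x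
  proof -
    have "Re (cnj (S (g x)) * h (g x)) = (norm (f (g x)))\<^sup>2 - (norm (f (g x) - S (g x)))\<^sup>2"
      unfolding h_def cmod_power2 by (simp add: power2_eq_square algebra_simps)
    also have "\<dots> \<le> (norm (f (g x)))\<^sup>2" by simp
    also have "\<dots> \<le> 1"
      using bd[of "g x"] g_norm[of x] r by (simp add: power_le_one)
    finally show ?thesis .
  qed
  ultimately show ?thesis
    unfolding c_def by (rule has_integral_le)
qed

lemma bessel_inequality:
  assumes f: "f holomorphic_on ball 0 1" and bd: "\<And>z. z \<in> ball 0 1 \<Longrightarrow> norm (f z) \<le> 1"
  shows "(\<Sum>n<N. (norm (fps_nth (fps_expansion f 0) n))\<^sup>2) \<le> 1"
proof -
  define s where
    "s r = (\<Sum>n<N. (norm (fps_nth (fps_expansion f 0) n))\<^sup>2 * r ^ (2 * n))" for r :: real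
  have "(s \<longlongrightarrow> s 1) (at_left 1)"
    unfolding s_def by (intro tendsto_intros)
  moreover have "eventually (\<lambda>r. s r \<le> 1) (at_left 1)"
    unfolding eventually_at_left_field
    by (intro exI[of _ 0]) (auto simp: s_def intro: bessel_inequality_scaled[OF f bd])
  ultimately have "s 1 \<le> 1"
    by (intro tendsto_upperbound[of s]) auto
  thus ?thesis by (simp add: s_def)
qed

section \<open>Taylor coefficients in terms of the Schwarz function\<close>

text \<open>The two recursions are the coefficient forms of \<open>(exp w)' = w' exp w\<close> and of
  \<open>z f'' + f' = f' exp w\<close>. The second equation is derived near \<open>0\<close>, where \<open>f'\<close> does not
  vanish because \<open>f' 0 = 1\<close>.\<close>

lemma class_Ce_recursions:
  assumes "f \<in> class_Ce"
  obtains c e :: "nat \<Rightarrow> complex" where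
    "\<And>N. (\<Sum>n<N. (norm (c n))\<^sup>2) \<le> 1"
    "e 0 = 1"
    "\<And>n. of_nat (Suc n) * e (Suc n) = (\<Sum>i\<le>n. of_nat (Suc i) * c (Suc i) * e (n - i))"
    "\<And>n. of_nat (n * Suc n) * taylor_coeff f (Suc n)
        + of_nat (Suc n) * taylor_coeff f (Suc n)
        = (\<Sum>i\<le>n. of_nat (Suc i) * taylor_coeff f (Suc i) * e (n - i))"
    "taylor_coeff f 1 = 1"
proof -
  have f: "f holomorphic_on ball 0 1" and a1: "taylor_coeff f 1 = 1"
    using assms by (auto simp: class_Ce_def normalized_class_def)
  obtain w where w: "w holomorphic_on ball 0 1" "w 0 = 0"
      "\<And>z. z \<in> ball 0 1 \<Longrightarrow> norm (w z) \<le> norm z"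
    and eq: "\<And>z. z \<in> ball 0 1 \<Longrightarrow> 1 + z * deriv (deriv f) z / deriv f z = exp (w z)"
    using assms unfolding class_Ce_def subordinate_def schwarz_function_def by auto
  define F where "F = fps_expansion f 0"
  define W where "W = fps_expansion w 0"
  define E where "E = fps_compose (fps_exp 1) W"
  have F: "f has_fps_expansion F"
    unfolding F_def by (rule has_fps_expansion_fps_expansion[OF _ _ f]) auto
  have W: "w has_fps_expansion W"
    unfolding W_def by (rule has_fps_expansion_fps_expansion[OF _ _ w(1)]) auto
  have W0: "fps_nth W 0 = 0"
    using has_fps_expansion_imp_0_eq_fps_nth_0[OF W] w(2) by simp
  have E: "(\<lambda>z. exp (w z)) has_fps_expansion E"
    using has_fps_expansion_compose[OF has_fps_expansion_exp1 W W0] by (simp add: E_def o_def)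
  have F': "deriv f has_fps_expansion fps_deriv F"
    by (intro fps_expansion_intros F)
  have deriv_0: "deriv f 0 = 1"
    using has_fps_expansion_imp_0_eq_fps_nth_0[OF F'] a1 by (simp add: F_def taylor_coeff_def)
  have "(deriv f \<longlongrightarrow> deriv f 0) (nhds 0)"
    using has_fps_expansion_imp_continuous[OF F', of UNIV]
    by (simp add: continuous_at tendsto_at_iff_tendsto_nhds)
  hence "eventually (\<lambda>z. deriv f z \<noteq> 0) (nhds 0)"
    by (rule tendsto_imp_eventually_ne) (simp add: deriv_0)
  moreover have "eventually (\<lambda>z. z \<in> ball 0 1) (nhds (0::complex))"
    by (intro eventually_nhds_in_open) auto
  ultimately have ev: "eventually (\<lambda>z. z * deriv (deriv f) z + deriv f z = deriv f z * exp (w z))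
      (nhds 0)"
  proof eventually_elim
    case (elim z)
    thus ?case using eq[of z] by (simp add: field_simps)
  qed
  have L: "(\<lambda>z. z * deriv (deriv f) z + deriv f z) has_fps_expansion
      fps_X * fps_deriv (fps_deriv F) + fps_deriv F"
    by (intro fps_expansion_intros F)
  have R: "(\<lambda>z. deriv f z * exp (w z)) has_fps_expansion fps_deriv F * E"
    by (intro fps_expansion_intros F E)
  have ode: "fps_X * fps_deriv (fps_deriv F) + fps_deriv F = fps_deriv F * E"
    using L R has_fps_expansion_cong[OF ev refl] fps_expansion_unique_complex by blast
  have E': "fps_deriv E = fps_deriv W * E"
    unfolding E_def by (simp add: fps_compose_deriv W0 mult.commute)
  show ?thesis
  proof (rule that[of "fps_nth W" "fps_nth E"])
    show "(\<Sum>n<N. (norm (fps_nth W n))\<^sup>2) \<le> 1" for N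
      unfolding W_def using w by (intro bessel_inequality) force+
    show "fps_nth E 0 = 1" by (simp add: E_def)
    show "of_nat (Suc n) * fps_nth E (Suc n)
        = (\<Sum>i\<le>n. of_nat (Suc i) * fps_nth W (Suc i) * fps_nth E (n - i))" for n
      using arg_cong[OF E', of "\<lambda>G. fps_nth G n"] by (simp add: fps_mult_nth atLeast0AtMost)
    show "of_nat (n * Suc n) * taylor_coeff f (Suc n)
        + of_nat (Suc n) * taylor_coeff f (Suc n)
        = (\<Sum>i\<le>n. of_nat (Suc i) * taylor_coeff f (Suc i) * fps_nth E (n - i))" for n
    proof -
      have "fps_nth (fps_X * fps_deriv (fps_deriv F) + fps_deriv F) n
          = of_nat (n * Suc n) * fps_nth F (Suc n) + of_nat (Suc n) * fps_nth F (Suc n)"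
        by (cases n) (simp_all add: algebra_simps)
      moreover have "fps_nth (fps_deriv F * E) n
          = (\<Sum>i\<le>n. of_nat (Suc i) * fps_nth F (Suc i) * fps_nth E (n - i))"
        by (simp add: fps_mult_nth atLeast0AtMost)
      ultimately show ?thesis
        unfolding ode by (simp add: F_def taylor_coeff_def)
    qed
    show "taylor_coeff f 1 = 1" by fact
  qed
qed

text \<open>Solving the recursions one index at a time; \<open>e\<close> stands for the coefficients of \<open>exp w\<close>.\<close>

lemma coefficient_formulas:
  fixes a c e :: "nat \<Rightarrow> complex"
  assumes "e 0 = 1"
    and e: "\<And>n. of_nat (Suc n) * e (Suc n) = (\<Sum>i\<le>n. of_nat (Suc i) * c (Suc i) * e (n - i))"
    and a: "\<And>n. of_nat (n * Suc n) * a (Suc n) + of_nat (Suc n) * a (Suc n)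
        = (\<Sum>i\<le>n. of_nat (Suc i) * a (Suc i) * e (n - i))"
    and "a 1 = 1"
  shows "a 2 = c 1 / 2"
    and "a 3 = c 1 ^ 2 / 4 + c 2 / 6"
    and "a 4 = 17/144 * c 1 ^ 3 + 5/24 * c 1 * c 2 + c 3 / 12"
    and "a 5 = 19/360 * c 1 ^ 4 + c 1 ^ 2 * c 2 / 6 + 7/60 * c 1 * c 3 + c 2 ^ 2 / 20 + c 4 / 20"
    and "a 6 = 9/400 * c 1 ^ 5 + 29/270 * c 1 ^ 3 * c 2 + c 1 ^ 2 * c 3 / 10
      + 31/360 * c 1 * c 2 ^ 2 + 3/40 * c 1 * c 4 + 11/180 * c 2 * c 3 + c 5 / 30"
    and "a 7 = 1193/129600 * c 1 ^ 6 + 1829/30240 * c 1 ^ 4 * c 2 + 1021/15120 * c 1 ^ 3 * c 3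
      + 221/2520 * c 1 ^ 2 * c 2 ^ 2 + 113/1680 * c 1 ^ 2 * c 4 + 277/2520 * c 1 * c 2 * c 3
      + 11/210 * c 1 * c 5 + c 2 ^ 3 / 63 + c 2 * c 4 / 24 + 5/252 * c 3 ^ 2 + c 6 / 42"
proof -
  have e0: "e 0 = 1" and a1: "a (Suc 0) = 1" using assms(1,4) by simp_all
  have cancel: "x = z" if "k * x = y" "k \<noteq> 0" "y = k * z" for k x y z :: complex
    using that by simp
  note unroll = eval_nat_numeral algebra_simps
  have e1: "e 1 = c 1"
    using e[of 0] e0 by simp
  have "2 * e 2 = c 1 * e 1 + 2 * c 2"
    using e[of 1] e0 by (simp add: unroll)
  hence e2: "e 2 = c 1 ^ 2 / 2 + c 2"
    by (rule cancel) (simp, unfold e1, simp add: field_simps eval_nat_numeral)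
  have "3 * e 3 = c 1 * e 2 + 2 * c 2 * e 1 + 3 * c 3"
    using e[of 2] e0 by (simp add: unroll)
  hence e3: "e 3 = c 1 ^ 3 / 6 + c 1 * c 2 + c 3"
    by (rule cancel) (simp, unfold e1 e2, simp add: field_simps eval_nat_numeral)
  have "4 * e 4 = c 1 * e 3 + 2 * c 2 * e 2 + 3 * c 3 * e 1 + 4 * c 4"
    using e[of 3] e0 by (simp add: unroll)
  hence e4: "e 4 = c 1 ^ 4 / 24 + c 1 ^ 2 * c 2 / 2 + c 1 * c 3 + c 2 ^ 2 / 2 + c 4"
    by (rule cancel) (simp, unfold e1 e2 e3, simp add: field_simps eval_nat_numeral)
  have "5 * e 5 = c 1 * e 4 + 2 * c 2 * e 3 + 3 * c 3 * e 2 + 4 * c 4 * e 1 + 5 * c 5"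
    using e[of 4] e0 by (simp add: unroll)
  hence e5: "e 5 = c 1 ^ 5 / 120 + c 1 ^ 3 * c 2 / 6 + c 1 ^ 2 * c 3 / 2 + c 1 * c 2 ^ 2 / 2
      + c 1 * c 4 + c 2 * c 3 + c 5"
    by (rule cancel) (simp, unfold e1 e2 e3 e4, simp add: field_simps eval_nat_numeral)
  have "6 * e 6 = c 1 * e 5 + 2 * c 2 * e 4 + 3 * c 3 * e 3 + 4 * c 4 * e 2 + 5 * c 5 * e 1 + 6 * c 6"
    using e[of 5] e0 by (simp add: unroll)
  hence e6: "e 6 = c 1 ^ 6 / 720 + c 1 ^ 4 * c 2 / 24 + c 1 ^ 3 * c 3 / 6 + c 1 ^ 2 * c 2 ^ 2 / 4
      + c 1 ^ 2 * c 4 / 2 + c 1 * c 2 * c 3 + c 1 * c 5 + c 2 ^ 3 / 6 + c 2 * c 4 + c 3 ^ 2 / 2 + c 6"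
    by (rule cancel) (simp, unfold e1 e2 e3 e4 e5, simp add: field_simps eval_nat_numeral)
  have "2 * a 2 = e 1"
    using a[of 1] e0 a1 by (simp add: unroll)
  thus a2: "a 2 = c 1 / 2"
    by (rule cancel) (simp, unfold e1, simp)
  have "6 * a 3 = e 2 + 2 * a 2 * e 1"
    using a[of 2] e0 a1 by (simp add: unroll)
  thus a3: "a 3 = c 1 ^ 2 / 4 + c 2 / 6"
    by (rule cancel) (simp, unfold e1 e2 a2, simp add: field_simps eval_nat_numeral)
  have "12 * a 4 = e 3 + 2 * a 2 * e 2 + 3 * a 3 * e 1"
    using a[of 3] e0 a1 by (simp add: unroll)
  thus a4: "a 4 = 17/144 * c 1 ^ 3 + 5/24 * c 1 * c 2 + c 3 / 12"
    by (rule cancel) (simp, unfold e1 e2 e3 a2 a3, simp add: field_simps eval_nat_numeral)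
  have "20 * a 5 = e 4 + 2 * a 2 * e 3 + 3 * a 3 * e 2 + 4 * a 4 * e 1"
    using a[of 4] e0 a1 by (simp add: unroll)
  thus a5: "a 5 = 19/360 * c 1 ^ 4 + c 1 ^ 2 * c 2 / 6 + 7/60 * c 1 * c 3 + c 2 ^ 2 / 20 + c 4 / 20"
    by (rule cancel) (simp, unfold e1 e2 e3 e4 a2 a3 a4, simp add: field_simps eval_nat_numeral)
  have "30 * a 6 = e 5 + 2 * a 2 * e 4 + 3 * a 3 * e 3 + 4 * a 4 * e 2 + 5 * a 5 * e 1"
    using a[of 5] e0 a1 by (simp add: unroll)
  thus a6: "a 6 = 9/400 * c 1 ^ 5 + 29/270 * c 1 ^ 3 * c 2 + c 1 ^ 2 * c 3 / 10
      + 31/360 * c 1 * c 2 ^ 2 + 3/40 * c 1 * c 4 + 11/180 * c 2 * c 3 + c 5 / 30"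
    by (rule cancel) (simp, unfold e1 e2 e3 e4 e5 a2 a3 a4 a5, simp add: field_simps eval_nat_numeral)
  have "42 * a 7 = e 6 + 2 * a 2 * e 5 + 3 * a 3 * e 4 + 4 * a 4 * e 3 + 5 * a 5 * e 2 + 6 * a 6 * e 1"
    using a[of 6] e0 a1 by (simp add: unroll)
  thus "a 7 = 1193/129600 * c 1 ^ 6 + 1829/30240 * c 1 ^ 4 * c 2 + 1021/15120 * c 1 ^ 3 * c 3
      + 221/2520 * c 1 ^ 2 * c 2 ^ 2 + 113/1680 * c 1 ^ 2 * c 4 + 277/2520 * c 1 * c 2 * c 3
      + 11/210 * c 1 * c 5 + c 2 ^ 3 / 63 + c 2 * c 4 / 24 + 5/252 * c 3 ^ 2 + c 6 / 42"
    by (rule cancel) (simp, unfold e1 e2 e3 e4 e5 e6 a2 a3 a4 a5 a6, simp add: field_simps eval_nat_numeral)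
qed

section \<open>The Hankel determinant and its reduction\<close>

text \<open>The determinant of the symmetric \<open>3 \<times> 3\<close> matrix with the given entries on and above the
  diagonal, as an explicit polynomial so that it can be estimated term by term.\<close>

definition sym_det3 :: "'a::comm_ring_1 \<Rightarrow> 'a \<Rightarrow> 'a \<Rightarrow> 'a \<Rightarrow> 'a \<Rightarrow> 'a \<Rightarrow> 'a" where
  "sym_det3 m11 m12 m13 m22 m23 m33 =
     m11 * m22 * m33 + 2 * m12 * m13 * m23 - m13\<^sup>2 * m22 - m12\<^sup>2 * m33 - m23\<^sup>2 * m11"

text \<open>Subtract \<open>\<alpha>\<close> times the first row from the second, then \<open>\<beta>\<close> times the new second row and \<open>\<gamma>\<close>
  times the first row from the third, and do the same with the columns. The hypotheses compute the
  entries of the resulting matrix.\<close>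

lemma sym_det3_congruence:
  fixes \<alpha> \<beta> \<gamma> :: "'a::comm_ring_1"
  assumes "n12 = m12 - \<alpha> * m11"
    and "n22 = m22 - 2 * \<alpha> * m12 + \<alpha>\<^sup>2 * m11"
    and "n13 = m13 - \<beta> * n12 - \<gamma> * m11"
    and "n23 = (m23 - \<alpha> * m13) - \<beta> * n22 - \<gamma> * n12"
    and "n33 = m33 - 2 * \<beta> * (m23 - \<alpha> * m13) - 2 * \<gamma> * m13
           + \<beta>\<^sup>2 * n22 + 2 * \<beta> * \<gamma> * n12 + \<gamma>\<^sup>2 * m11"
  shows "sym_det3 m11 n12 n13 n22 n23 n33 = sym_det3 m11 m12 m13 m22 m23 m33"
  unfolding sym_det3_def assms by (simp add: algebra_simps power2_eq_square)

text \<open>Laplace expansion along the first row, stated for matrices given by an entry function so that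
  it can be iterated by rewriting.\<close>

lemma det_mat_Suc:
  fixes g :: "nat \<times> nat \<Rightarrow> 'a::comm_ring_1"
  shows "Determinant.det (Matrix.mat (Suc n) (Suc n) g) =
     (\<Sum>j<Suc n. (-1) ^ j * g (0, j) *
        Determinant.det (Matrix.mat n n (\<lambda>(i, k). g (Suc i, if k < j then k else Suc k))))"
proof -
  have "mat_delete (Matrix.mat (Suc n) (Suc n) g) 0 j
      = Matrix.mat n n (\<lambda>(i, k). g (Suc i, if k < j then k else Suc k))" for j
    by (rule eq_matI) (auto simp: mat_delete_def)
  thus ?thesis
    by (subst laplace_expansion_row[of _ "Suc n" 0])
       (auto simp: cofactor_def mult_ac intro!: sum.cong)
qed

text \<open>Clearing the first row and column with the corner entry \<open>a\<^sub>1 = 1\<close> leaves the Schur complement.\<close>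

lemma hankel_det_4_1:
  assumes "taylor_coeff f 1 = 1"
  defines "a \<equiv> taylor_coeff f"
  shows "hankel_det f 4 1 = sym_det3 (a 3 - a 2 ^ 2) (a 4 - a 2 * a 3) (a 5 - a 2 * a 4)
           (a 5 - a 3 ^ 2) (a 6 - a 3 * a 4) (a 7 - a 4 ^ 2)"
proof -
  have a1: "a (Suc 0) = 1" using assms by simp
  have four: "4 = Suc (Suc (Suc (Suc 0)))" by simp
  show ?thesis
    unfolding hankel_det_def a_def[symmetric] four det_mat_Suc
    by (simp add: a1 sym_det3_def eval_nat_numeral algebra_simps)
qed

text \<open>The three multipliers are chosen to remove \<open>c\<^sub>1 c\<^sub>2\<close> from the second entry and everything but
  \<open>c\<^sub>4/20\<close> from the third: \<open>3/4 c\<^sub>1 \<cdot> c\<^sub>2/6 = c\<^sub>1 c\<^sub>2/8\<close>, then \<open>9/10 c\<^sub>1 \<cdot> c\<^sub>3/12 = 3/40 c\<^sub>1 c\<^sub>3\<close>,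
  and \<open>(3/10 c\<^sub>2 + 3/8 c\<^sub>1\<^sup>2) \<cdot> c\<^sub>2/6 = c\<^sub>2\<^sup>2/20 + c\<^sub>1\<^sup>2 c\<^sub>2/16\<close>. The terms in \<open>c\<^sub>1\<^sup>4\<close> cancel as well.\<close>

lemma hankel_reduced:
  fixes c :: "nat \<Rightarrow> complex"
  assumes a2: "a2 = c 1 / 2"
    and a3: "a3 = c 1 ^ 2 / 4 + c 2 / 6"
    and a4: "a4 = 17/144 * c 1 ^ 3 + 5/24 * c 1 * c 2 + c 3 / 12"
    and a5: "a5 = 19/360 * c 1 ^ 4 + c 1 ^ 2 * c 2 / 6 + 7/60 * c 1 * c 3 + c 2 ^ 2 / 20 + c 4 / 20"
    and a6: "a6 = 9/400 * c 1 ^ 5 + 29/270 * c 1 ^ 3 * c 2 + c 1 ^ 2 * c 3 / 10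
      + 31/360 * c 1 * c 2 ^ 2 + 3/40 * c 1 * c 4 + 11/180 * c 2 * c 3 + c 5 / 30"
    and a7: "a7 = 1193/129600 * c 1 ^ 6 + 1829/30240 * c 1 ^ 4 * c 2 + 1021/15120 * c 1 ^ 3 * c 3
      + 221/2520 * c 1 ^ 2 * c 2 ^ 2 + 113/1680 * c 1 ^ 2 * c 4 + 277/2520 * c 1 * c 2 * c 3
      + 11/210 * c 1 * c 5 + c 2 ^ 3 / 63 + c 2 * c 4 / 24 + 5/252 * c 3 ^ 2 + c 6 / 42"
  shows "sym_det3 (a3 - a2 ^ 2) (a4 - a2 * a3) (a5 - a2 * a4)
           (a5 - a3 ^ 2) (a6 - a3 * a4) (a7 - a4 ^ 2) =
     sym_det3
       (c 2 / 6)
       ((-1/144) * c 1 ^ 3 + c 3 / 12)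
       (c 4 / 20)
       (1/1440 * c 1 ^ 4 + (-1/96) * (c 1 ^ 2 * c 2) + (-1/120) * (c 1 * c 3)
         + 1/45 * c 2 ^ 2 + c 4 / 20)
       ((-1/2880) * c 1 ^ 5 + 1/4320 * (c 1 ^ 3 * c 2) + (-1/1200) * (c 1 ^ 2 * c 3)
         + (-11/1800) * (c 1 * c 2 ^ 2) + (-3/400) * (c 1 * c 4) + 1/45 * (c 2 * c 3) + c 5 / 30)
       (47/2592000 * c 1 ^ 6 + (-113/302400) * (c 1 ^ 4 * c 2)
         + (-113/756000) * (c 1 ^ 3 * c 3)
         + (-103/504000) * (c 1 ^ 2 * c 2 ^ 2) + 29/10500 * (c 1 ^ 2 * c 4)
         + (-247/25200) * (c 1 * c 2 * c 3) + (-4/525) * (c 1 * c 5) + 11/12600 * c 2 ^ 3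
         + 7/600 * (c 2 * c 4) + 13/1008 * c 3 ^ 2 + c 6 / 42)"
proof -
  have m11: "a3 - a2 ^ 2 = c 2 / 6"
    unfolding a2 a3 by (simp add: power2_eq_square)
  show ?thesis unfolding m11
    by (rule sym_det3_congruence[symmetric, where \<alpha> = "3/4 * c 1" and \<beta> = "9/10 * c 1"
          and \<gamma> = "3/10 * c 2 + 3/8 * c 1 ^ 2"])
       (unfold a2 a3 a4 a5 a6 a7, simp_all add: field_simps eval_nat_numeral)
qed

section \<open>Estimating the reduced determinant\<close>

text \<open>The left-hand sides are the reduced entries with every coefficient and every \<open>c\<^sub>i\<close> replaced by
  its absolute value. Unless it stands alone, the linear term \<open>x/k\<close> is estimated by
  \<open>x \<le> (1 + x\<^sup>2)/2\<close>, which leaves \<open>(1 - x\<^sup>2)/(2k)\<close> of the bound \<open>1/k\<close> for the other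
  monomials. These are dominated by a combination of squares of the remaining variables, whose
  coefficients are at most \<open>1/(2k)\<close>. Only in the last entry do those of \<open>x1\<^sup>2\<close> and \<open>x3\<^sup>2\<close> come out slightly above \<open>1/84\<close>, which is why
  \<open>1/40\<close> appears there instead of \<open>1/42\<close>.\<close>

lemma reduced_entry_bounds:
  fixes x1 x2 x3 x4 x5 x6 :: real
  assumes nonneg: "0 \<le> x1" "0 \<le> x2" "0 \<le> x3" "0 \<le> x4" "0 \<le> x5" "0 \<le> x6"
    and sum_le: "x1\<^sup>2 + x2\<^sup>2 + x3\<^sup>2 + x4\<^sup>2 + x5\<^sup>2 + x6\<^sup>2 \<le> 1"
  shows "x2 / 6 \<le> 1 / 6"
    and "1/144 * x1 ^ 3 + x3 / 12 \<le> 1 / 12"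
    and "x4 / 20 \<le> 1 / 20"
    and "1/1440 * x1 ^ 4 + 1/96 * (x1 ^ 2 * x2) + 1/120 * (x1 * x3) + 1/45 * x2 ^ 2 + x4 / 20
      \<le> 1 / 20"
    and "1/2880 * x1 ^ 5 + 1/4320 * (x1 ^ 3 * x2) + 1/1200 * (x1 ^ 2 * x3)
      + 11/1800 * (x1 * x2 ^ 2) + 3/400 * (x1 * x4) + 1/45 * (x2 * x3) + x5 / 30 \<le> 1 / 30"
    and "47/2592000 * x1 ^ 6 + 113/302400 * (x1 ^ 4 * x2) + 113/756000 * (x1 ^ 3 * x3)
      + 103/504000 * (x1 ^ 2 * x2 ^ 2) + 29/10500 * (x1 ^ 2 * x4) + 247/25200 * (x1 * x2 * x3)
      + 4/525 * (x1 * x5) + 11/12600 * x2 ^ 3 + 7/600 * (x2 * x4) + 13/1008 * x3 ^ 2 + x6 / 42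
      \<le> 1 / 40"
proof -
  have sq: "0 \<le> x1\<^sup>2" "0 \<le> x2\<^sup>2" "0 \<le> x3\<^sup>2" "0 \<le> x4\<^sup>2" "0 \<le> x5\<^sup>2" "0 \<le> x6\<^sup>2"
    by simp_all
  have one: "x \<le> 1" if "x\<^sup>2 \<le> 1" for x :: real
    using that power2_le_imp_le[of x 1] by simp
  have le1: "x1 \<le> 1" "x2 \<le> 1" "x3 \<le> 1" "x4 \<le> 1"
    by (rule one, use sum_le sq in linarith)+
  have amgm: "u * v \<le> (u\<^sup>2 + v\<^sup>2) / 2" for u v :: real
    using sum_squares_bound[of u v] by simp
  have lin: "x \<le> (1 + x\<^sup>2) / 2" for x :: real
    using amgm[of 1 x] by simp
  have drop: "x1 ^ 2 * y \<le> x1 ^ 2" if "y \<le> 1" for y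
    using that by (simp add: mult_left_le)
  have mono:
    "x1 ^ 3 \<le> x1 ^ 2" "x1 ^ 4 \<le> x1 ^ 2" "x1 ^ 5 \<le> x1 ^ 2" "x1 ^ 6 \<le> x1 ^ 2" "x2 ^ 3 \<le> x2 ^ 2"
    using nonneg le1 by (auto intro!: power_decreasing)
  have mono2: "x1 ^ 2 * x2 \<le> x1 ^ 2" "x1 ^ 2 * x3 \<le> x1 ^ 2" "x1 ^ 2 * x4 \<le> x1 ^ 2"
     "x1 ^ 2 * x2 ^ 2 \<le> x1 ^ 2"
    using nonneg le1 by (auto intro!: drop power_le_one)
  have mono3: "x1 ^ 3 * x2 \<le> x1 ^ 2" "x1 ^ 3 * x3 \<le> x1 ^ 2" "x1 ^ 4 * x2 \<le> x1 ^ 2"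
    using mono mono2 mult_right_mono[OF mono(1) nonneg(2)] mult_right_mono[OF mono(1) nonneg(3)]
      mult_right_mono[OF mono(2) nonneg(2)] by linarith+
  have mixed: "x1 * x2 ^ 2 \<le> (x1\<^sup>2 + x2\<^sup>2) / 2" "x1 * x2 * x3 \<le> (x1\<^sup>2 + x2\<^sup>2) / 2"
    using nonneg le1 amgm[of x1 x2] mult_left_le[of x2 "x1 * x2"] mult_left_le[of x3 "x1 * x2"]
    by (simp_all add: power2_eq_square mult.assoc)
  show "x2 / 6 \<le> 1 / 6" "x4 / 20 \<le> 1 / 20"
    using le1 by simp_all
  have "1/144 * x1 ^ 3 + x3 / 12 \<le> 1/144 * x1\<^sup>2 + ((1 + x3\<^sup>2) / 2) / 12"
    by (intro add_mono mult_left_mono divide_right_mono mono lin) simp_all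
  also have "\<dots> \<le> 1 / 12"
    using sum_le sq by argo
  finally show "1/144 * x1 ^ 3 + x3 / 12 \<le> 1 / 12" .
  have "1/1440 * x1 ^ 4 + 1/96 * (x1 ^ 2 * x2) + 1/120 * (x1 * x3) + 1/45 * x2 ^ 2 + x4 / 20
      \<le> 1/1440 * x1\<^sup>2 + 1/96 * x1\<^sup>2 + 1/120 * ((x1\<^sup>2 + x3\<^sup>2) / 2) + 1/45 * x2\<^sup>2 + ((1 + x4\<^sup>2) / 2) / 20"
    by (intro add_mono mult_left_mono divide_right_mono mono mono2 amgm lin) simp_all
  also have "\<dots> \<le> 1 / 20"
    using sum_le sq by argo
  finally show "1/1440 * x1 ^ 4 + 1/96 * (x1 ^ 2 * x2) + 1/120 * (x1 * x3) + 1/45 * x2 ^ 2 + x4 / 20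
      \<le> 1 / 20" .
  have "1/2880 * x1 ^ 5 + 1/4320 * (x1 ^ 3 * x2) + 1/1200 * (x1 ^ 2 * x3) + 11/1800 * (x1 * x2 ^ 2)
      + 3/400 * (x1 * x4) + 1/45 * (x2 * x3) + x5 / 30
      \<le> 1/2880 * x1\<^sup>2 + 1/4320 * x1\<^sup>2 + 1/1200 * x1\<^sup>2 + 11/1800 * ((x1\<^sup>2 + x2\<^sup>2) / 2)
      + 3/400 * ((x1\<^sup>2 + x4\<^sup>2) / 2) + 1/45 * ((x2\<^sup>2 + x3\<^sup>2) / 2) + ((1 + x5\<^sup>2) / 2) / 30"
    by (intro add_mono mult_left_mono divide_right_mono mono mono2 mono3 mixed amgm lin) simp_all
  also have "\<dots> \<le> 1 / 30"
    using sum_le sq by argo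
  finally show "1/2880 * x1 ^ 5 + 1/4320 * (x1 ^ 3 * x2) + 1/1200 * (x1 ^ 2 * x3)
      + 11/1800 * (x1 * x2 ^ 2) + 3/400 * (x1 * x4) + 1/45 * (x2 * x3) + x5 / 30 \<le> 1 / 30" .
  have "47/2592000 * x1 ^ 6 + 113/302400 * (x1 ^ 4 * x2) + 113/756000 * (x1 ^ 3 * x3)
      + 103/504000 * (x1 ^ 2 * x2 ^ 2) + 29/10500 * (x1 ^ 2 * x4) + 247/25200 * (x1 * x2 * x3)
      + 4/525 * (x1 * x5) + 11/12600 * x2 ^ 3 + 7/600 * (x2 * x4) + 13/1008 * x3 ^ 2 + x6 / 42
      \<le> 47/2592000 * x1\<^sup>2 + 113/302400 * x1\<^sup>2 + 113/756000 * x1\<^sup>2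
      + 103/504000 * x1\<^sup>2 + 29/10500 * x1\<^sup>2 + 247/25200 * ((x1\<^sup>2 + x2\<^sup>2) / 2)
      + 4/525 * ((x1\<^sup>2 + x5\<^sup>2) / 2) + 11/12600 * x2\<^sup>2 + 7/600 * ((x2\<^sup>2 + x4\<^sup>2) / 2)
      + 13/1008 * x3\<^sup>2 + ((1 + x6\<^sup>2) / 2) / 42"
    by (intro add_mono mult_left_mono divide_right_mono mono mono2 mono3 mixed amgm lin) simp_all
  also have "\<dots> \<le> 1 / 40"
    using sum_le sq by argo
  finally show "47/2592000 * x1 ^ 6 + 113/302400 * (x1 ^ 4 * x2) + 113/756000 * (x1 ^ 3 * x3)
      + 103/504000 * (x1 ^ 2 * x2 ^ 2) + 29/10500 * (x1 ^ 2 * x4) + 247/25200 * (x1 * x2 * x3)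
      + 4/525 * (x1 * x5) + 11/12600 * x2 ^ 3 + 7/600 * (x2 * x4) + 13/1008 * x3 ^ 2 + x6 / 42
      \<le> 1 / 40" .
qed

lemma reduced_entry_norms:
  fixes c :: "nat \<Rightarrow> complex"
  assumes sum_le: "(\<Sum>n<7. (norm (c n))\<^sup>2) \<le> 1"
  shows "norm (c 2 / 6) \<le> 1/6"
    and "norm ((-1/144) * c 1 ^ 3 + c 3 / 12) \<le> 1/12"
    and "norm (c 4 / 20) \<le> 1/20"
    and "norm (1/1440 * c 1 ^ 4 + (-1/96) * (c 1 ^ 2 * c 2) + (-1/120) * (c 1 * c 3)
         + 1/45 * c 2 ^ 2 + c 4 / 20) \<le> 1/20"
    and "norm ((-1/2880) * c 1 ^ 5 + 1/4320 * (c 1 ^ 3 * c 2) + (-1/1200) * (c 1 ^ 2 * c 3)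
         + (-11/1800) * (c 1 * c 2 ^ 2) + (-3/400) * (c 1 * c 4) + 1/45 * (c 2 * c 3) + c 5 / 30)
         \<le> 1/30"
    and "norm (47/2592000 * c 1 ^ 6 + (-113/302400) * (c 1 ^ 4 * c 2)
         + (-113/756000) * (c 1 ^ 3 * c 3)
         + (-103/504000) * (c 1 ^ 2 * c 2 ^ 2) + 29/10500 * (c 1 ^ 2 * c 4)
         + (-247/25200) * (c 1 * c 2 * c 3) + (-4/525) * (c 1 * c 5) + 11/12600 * c 2 ^ 3
         + 7/600 * (c 2 * c 4) + 13/1008 * c 3 ^ 2 + c 6 / 42) \<le> 1/40"
proof -
  have "(norm (c 1))\<^sup>2 + (norm (c 2))\<^sup>2 + (norm (c 3))\<^sup>2
      + (norm (c 4))\<^sup>2 + (norm (c 5))\<^sup>2 + (norm (c 6))\<^sup>2 \<le> (\<Sum>n<7. (norm (c n))\<^sup>2)"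
    by (simp add: eval_nat_numeral)
  also note sum_le
  finally have sum_le': "(norm (c 1))\<^sup>2 + (norm (c 2))\<^sup>2 + (norm (c 3))\<^sup>2
      + (norm (c 4))\<^sup>2 + (norm (c 5))\<^sup>2 + (norm (c 6))\<^sup>2 \<le> 1" .
  note bounds = reduced_entry_bounds[OF norm_ge_zero norm_ge_zero norm_ge_zero norm_ge_zero
      norm_ge_zero norm_ge_zero sum_le']
  show "norm (c 2 / 6) \<le> 1/6"
    by (rule order_trans[OF _ bounds(1)])
       (simp_all add: norm_mult norm_power norm_divide)
  show "norm ((-1/144) * c 1 ^ 3 + c 3 / 12) \<le> 1/12"
    by (rule order_trans[OF _ bounds(2)], intro norm_triangle_mono)
       (simp_all add: norm_mult norm_power norm_divide)
  show "norm (c 4 / 20) \<le> 1/20"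
    by (rule order_trans[OF _ bounds(3)])
       (simp_all add: norm_mult norm_power norm_divide)
  show "norm (1/1440 * c 1 ^ 4 + (-1/96) * (c 1 ^ 2 * c 2) + (-1/120) * (c 1 * c 3)
         + 1/45 * c 2 ^ 2 + c 4 / 20) \<le> 1/20"
    by (rule order_trans[OF _ bounds(4)], intro norm_triangle_mono)
       (simp_all add: norm_mult norm_power norm_divide)
  show "norm ((-1/2880) * c 1 ^ 5 + 1/4320 * (c 1 ^ 3 * c 2) + (-1/1200) * (c 1 ^ 2 * c 3)
         + (-11/1800) * (c 1 * c 2 ^ 2) + (-3/400) * (c 1 * c 4) + 1/45 * (c 2 * c 3) + c 5 / 30)
         \<le> 1/30"
    by (rule order_trans[OF _ bounds(5)], intro norm_triangle_mono)
       (simp_all add: norm_mult norm_power norm_divide)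
  show "norm (47/2592000 * c 1 ^ 6 + (-113/302400) * (c 1 ^ 4 * c 2)
         + (-113/756000) * (c 1 ^ 3 * c 3)
         + (-103/504000) * (c 1 ^ 2 * c 2 ^ 2) + 29/10500 * (c 1 ^ 2 * c 4)
         + (-247/25200) * (c 1 * c 2 * c 3) + (-4/525) * (c 1 * c 5) + 11/12600 * c 2 ^ 3
         + 7/600 * (c 2 * c 4) + 13/1008 * c 3 ^ 2 + c 6 / 42) \<le> 1/40"
    by (rule order_trans[OF _ bounds(6)], intro norm_triangle_mono)
       (simp_all add: norm_mult norm_power norm_divide)
qed

lemma sym_det3_norm_le:
  fixes m11 m12 m13 m22 m23 m33 :: complex
  assumes "norm m11 \<le> b11" "norm m12 \<le> b12" "norm m13 \<le> b13"
    "norm m22 \<le> b22" "norm m23 \<le> b23" "norm m33 \<le> b33"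
  shows "norm (sym_det3 m11 m12 m13 m22 m23 m33) \<le>
     b11 * b22 * b33 + 2 * b12 * b13 * b23 + b13\<^sup>2 * b22 + b12\<^sup>2 * b33 + b23\<^sup>2 * b11"
proof -
  have b: "0 \<le> b11" "0 \<le> b12" "0 \<le> b13" "0 \<le> b22" "0 \<le> b23" "0 \<le> b33"
    using assms by (meson norm_ge_zero order_trans)+
  show ?thesis
    unfolding sym_det3_def diff_conv_add_uminus
    by (intro norm_triangle_mono)
       (auto simp: norm_mult norm_power intro!: mult_mono power_mono assms b mult_nonneg_nonneg)
qed

text \<open>
  The six bounds of \<open>reduced_entry_bounds\<close> give
  \<open>1/4800 + 1/3600 + 1/8000 + 1/5760 + 1/5400 < 0.00098\<close>.
\<close>

theorem theorem3p5:
  fixes f :: "complex \<Rightarrow> complex"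
  assumes "f \<in> class_Ce"
  shows "norm (hankel_det f 4 1) \<le> 0.00101775"
proof -
  obtain c e :: "nat \<Rightarrow> complex" where
    bessel: "\<And>N. (\<Sum>n<N. (norm (c n))\<^sup>2) \<le> 1"
    and rec: "e 0 = 1"
      "\<And>n. of_nat (Suc n) * e (Suc n) = (\<Sum>i\<le>n. of_nat (Suc i) * c (Suc i) * e (n - i))"
      "\<And>n. of_nat (n * Suc n) * taylor_coeff f (Suc n)
          + of_nat (Suc n) * taylor_coeff f (Suc n)
          = (\<Sum>i\<le>n. of_nat (Suc i) * taylor_coeff f (Suc i) * e (n - i))"
      "taylor_coeff f 1 = 1"
    by (rule class_Ce_recursions[OF assms]) blast
  note reduced = hankel_reduced[OF coefficient_formulas[OF rec]]
  have "norm (hankel_det f 4 1) \<le>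
      1/6 * (1/20) * (1/40) + 2 * (1/12) * (1/20) * (1/30)
      + (1/20)\<^sup>2 * (1/20) + (1/12)\<^sup>2 * (1/40) + (1/30)\<^sup>2 * (1/6)"
    unfolding hankel_det_4_1[OF rec(4)] reduced
    by (rule sym_det3_norm_le[OF reduced_entry_norms[OF bessel]])
  also have "\<dots> \<le> 0.00101775"
    by (simp add: power2_eq_square)
  finally show ?thesis .
qed

end
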